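(* Let $n\geq 1$ and let $i$ be an integer with $\lceil n/3\rceil\leq i\leq \lfloor n/2\rfloor$. Then $$d_a(P_n,i)\geq \sum_{k=3}^{i} d(P_{n-k},i-k+1)+\sum_{k=5}^{i+1} d(P_{n-k},i-k+2).$$
   Context: $P_m$ denotes the path on $m$ vertices. A dominating set of a graph $G=(V,E)$ is a set $D\subseteq V$ such that every vertex not in $D$ is adjacent to some vertex of $D$. A dominating set $D$ is accurate if no $|D|$-element subset of $V\setminus D$ is a dominating set of $G$. $d(G,j)$ is the number of dominating sets of $G$ of cardinality $j$ and $d_a(G,j)$ the number of accurate dominating sets of $G$ of cardinality $j$. Empty sums are $0$. *)

theory Defs
  imports Complex_Main
begin

text \<open>
  A graph is a pair of a vertex set and an edge set; an edge between distinct vertices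
  \<open>u\<close> and \<open>v\<close> is the unordered pair \<open>{u, v}\<close>.
  The notions below are meant for finite graphs: they measure sets with \<^const>\<open>card\<close>,
  which is \<open>0\<close> on infinite sets.
\<close>

type_synonym 'a graph = "'a set \<times> 'a set set"

definition verts :: "'a graph \<Rightarrow> 'a set" where
  "verts G = fst G"

definition edges :: "'a graph \<Rightarrow> 'a set set" where
  "edges G = snd G"

definition adjacent :: "'a graph \<Rightarrow> 'a \<Rightarrow> 'a \<Rightarrow> bool" where
  "adjacent G u v \<longleftrightarrow> u \<noteq> v \<and> {u, v} \<in> edges G"

definition dominating_set :: "'a graph \<Rightarrow> 'a set \<Rightarrow> bool" where
  "dominating_set G D \<longleftrightarrow>
     D \<subseteq> verts G \<and> (\<forall>v \<in> verts G - D. \<exists>u \<in> D. adjacent G u v)"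

definition accurate_dominating_set :: "'a graph \<Rightarrow> 'a set \<Rightarrow> bool" where
  "accurate_dominating_set G D \<longleftrightarrow>
     dominating_set G D \<and>
     \<not> (\<exists>S. S \<subseteq> verts G - D \<and> card S = card D \<and> dominating_set G S)"

definition num_dominating :: "'a graph \<Rightarrow> nat \<Rightarrow> nat" where
  "num_dominating G j = card {D. dominating_set G D \<and> card D = j}"

definition num_accurate_dominating :: "'a graph \<Rightarrow> nat \<Rightarrow> nat" where
  "num_accurate_dominating G j = card {D. accurate_dominating_set G D \<and> card D = j}"

definition path_graph :: "nat \<Rightarrow> nat graph" where
  "path_graph m = ({1..m}, {{j, j + 1} | j. 1 \<le> j \<and> j < m})"

end

theory Submission
  imports Defs
begin

text \<open>
  If a dominating set contains a closed neighbourhood then its complement contains no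
  dominating set, so it is accurate. The first sum counts the dominating sets whose
  complement has first element \<open>k \<ge> 3\<close>, that is, those which start with the run
  \<open>1, \<dots>, k - 1\<close>, and hence contain the closed neighbourhood of \<open>1\<close>, followed by a gap at \<open>k\<close>
  and a dominating set of the path on the vertices after \<open>k\<close>. The second sum counts those
  which miss \<open>1\<close>, start with the run \<open>2, \<dots>, k - 1\<close> where \<open>k \<ge> 5\<close>, and hence contain the
  closed neighbourhood of \<open>3\<close>, and continue in the same way.
\<close>

lemma verts_path_graph [simp]: "verts (path_graph n) = {1..n}"
  by (simp add: verts_def path_graph_def)

lemma adjacent_path_graph:
  "adjacent (path_graph n) u v \<longleftrightarrow>
     u \<in> {1..n} \<and> v \<in> {1..n} \<and> (u = Suc v \<or> v = Suc u)"
  by (auto simp: adjacent_def edges_def path_graph_def doubleton_eq_iff)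

text \<open>A set disjoint from \<open>D\<close> contains neither \<open>v\<close> nor a neighbour
  of \<open>v\<close>, so it leaves \<open>v\<close> undominated.\<close>

lemma accurate_dominating_setI:
  assumes "dominating_set G D" "v \<in> D" "\<And>u. adjacent G u v \<Longrightarrow> u \<in> D"
  shows "accurate_dominating_set G D"
  using assms unfolding accurate_dominating_set_def dominating_set_def by blast

text \<open>As long as \<open>0\<close> is not in \<open>D\<close>, the shifted copy starts after
  \<open>k\<close>, so \<open>k\<close> itself is the gap that ends the run.\<close>

definition prepend_run :: "nat \<Rightarrow> nat \<Rightarrow> nat set \<Rightarrow> nat set" where
  "prepend_run a k D = {a..<k} \<union> (\<lambda>x. x + k) ` D"

lemma card_prepend_run:
  assumes "finite D"
  shows "card (prepend_run a k D) = (k - a) + card D"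
proof -
  have "card ((\<lambda>x. x + k) ` D) = card D"
    by (intro card_image) (simp add: inj_on_def)
  then show ?thesis
    unfolding prepend_run_def using assms by (subst card_Un_disjoint) auto
qed

text \<open>The bound \<open>a \<le> 2\<close> leaves at most vertex 1 before the run, dominated by
  \<open>a\<close>. The gap \<open>k\<close> is dominated by \<open>k - 1\<close>, and later
  vertices by the shifted \<open>D\<close>.\<close>

lemma dominating_set_prepend_run:
  assumes D: "dominating_set (path_graph (n - k)) D"
    and a: "1 \<le> a" "a \<le> 2" "a < k" and k: "k \<le> n"
  shows "dominating_set (path_graph n) (prepend_run a k D)"
  unfolding dominating_set_def
proof (intro conjI ballI)
  show "prepend_run a k D \<subseteq> verts (path_graph n)"
    using D a k by (force simp: prepend_run_def dominating_set_def)
next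
  fix v assume v: "v \<in> verts (path_graph n) - prepend_run a k D"
  then have "v < a \<or> k \<le> v" by (auto simp: prepend_run_def)
  then consider "v < a" | "v = k" | "k < v" by linarith
  then show "\<exists>u\<in>prepend_run a k D. adjacent (path_graph n) u v"
  proof cases
    case 1
    then show ?thesis
      using v a k by (intro bexI[of _ a]) (auto simp: adjacent_path_graph prepend_run_def)
  next
    case 2
    then show ?thesis
      using v a k by (intro bexI[of _ "k - 1"]) (auto simp: adjacent_path_graph prepend_run_def)
  next
    case 3
    then have "v - k \<in> {1..n - k} - D"
      using v by (force simp: prepend_run_def)
    then obtain u where u: "u \<in> D" "adjacent (path_graph (n - k)) u (v - k)"
      using D unfolding dominating_set_def verts_path_graph by blast
    then show ?thesis
      using 3 k by (intro bexI[of _ "u + k"]) (auto simp: adjacent_path_graph prepend_run_def)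
  qed
qed

text \<open>The data can be read off the set: \<open>a\<close> is its least element,
  \<open>k\<close> the first number after \<open>a\<close> that it misses, and \<open>D\<close> what
  lies beyond \<open>k\<close>, shifted back.\<close>

lemma prepend_run_inject:
  assumes eq: "prepend_run a k D = prepend_run b l E"
    and "a < k" "b < l" "0 \<notin> D" "0 \<notin> E"
  shows "a = b \<and> k = l \<and> D = E"
proof -
  have first: "(LEAST x. x \<in> prepend_run c m F) = c" if "c < m" for c m F
    using that by (intro Least_equality) (auto simp: prepend_run_def)
  have gap: "(LEAST x. c \<le> x \<and> x \<notin> prepend_run c m F) = m" if "c < m" "0 \<notin> F" for c m F
    using that by (intro Least_equality) (auto simp: prepend_run_def intro: leI)
  have rest: "F = {x. 0 < x \<and> x + m \<in> prepend_run c m F}" if "0 \<notin> F" for c m F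
    using that by (auto simp: prepend_run_def intro: gr0I)
  have "a = b" using first assms by metis
  moreover from this have "k = l" using gap assms by metis
  ultimately show ?thesis using rest[of D k a] rest[of E l b] assms by simp
qed

lemma finite_dominating_sets_path_graph:
  "finite {D. dominating_set (path_graph n) D \<and> P D}"
  by (rule finite_subset[of _ "Pow {1..n}"]) (auto simp: dominating_set_def)

theorem theorem3p3:
  fixes n i :: nat
  assumes "n \<ge> 1"
    and "\<lceil>real n / 3\<rceil> \<le> int i"
    and "int i \<le> \<lfloor>real n / 2\<rfloor>"
  shows "num_accurate_dominating (path_graph n) i \<ge>
           (\<Sum>k = 3..i. num_dominating (path_graph (n - k)) (i - k + 1))
         + (\<Sum>k = 5..i + 1. num_dominating (path_graph (n - k)) (i + 2 - k))"
proof -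
  have "real i \<le> real n / 2"
    using assms(3) by linarith
  \<comment> \<open>This keeps every gap \<open>k \<le> i + 1\<close> inside the path.\<close>
  then have i: "i + 1 \<le> n"
    using assms(1) by linarith
  define I where "I = {1} \<times> {3..i} \<union> {2::nat} \<times> {5..i + 1}"
  \<comment> \<open>The run has \<open>k - a\<close> vertices, so \<open>i + a - k\<close> remain
    for \<open>D\<close>.\<close>
  define S where "S = (\<lambda>(a, k). {D. dominating_set (path_graph (n - k)) D \<and> card D = i + a - k})"
  define A where "A = {D. accurate_dominating_set (path_graph n) D \<and> card D = i}"
  define f where "f = (\<lambda>((a, k), D). prepend_run a k D)"
  have I: "1 \<le> a" "a \<le> 2" "a < k" "k \<le> n" "k \<le> i + a" "a = 1 \<and> 3 \<le> k \<or> a = 2 \<and> 5 \<le> k"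
    if "(a, k) \<in> I" for a k
    using that i by (auto simp: I_def)
  have S: "D \<subseteq> {1..n - k}" if "D \<in> S (a, k)" for a k D
    using that by (simp add: S_def dominating_set_def)
  have "inj_on f (Sigma I S)"
  proof (rule inj_onI)
    fix p q assume pq: "p \<in> Sigma I S" "q \<in> Sigma I S" "f p = f q"
    obtain a k D b l E where [simp]: "p = ((a, k), D)" "q = ((b, l), E)"
      by (metis surj_pair)
    have "a < k" "b < l" "0 \<notin> D" "0 \<notin> E"
      using pq(1,2) by (auto dest!: I(3) S)
    then show "p = q"
      using prepend_run_inject[of a k D b l E] pq(3) by (simp add: f_def)
  qed
  moreover have "f ` Sigma I S \<subseteq> A"
  proof (rule image_subsetI)
    fix p assume p: "p \<in> Sigma I S"
    obtain a k D where p_eq [simp]: "p = ((a, k), D)"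
      by (metis surj_pair)
    note ak = I[of a k]
    have D: "dominating_set (path_graph (n - k)) D" "card D = i + a - k" "finite D"
      using p S[of D a k] by (auto simp: S_def intro: finite_subset)
    \<comment> \<open>The closed neighbourhood of \<open>v\<close> lies in the run:
      \<open>{1, 2}\<close> if \<open>a = 1\<close> and \<open>k \<ge> 3\<close>,
      \<open>{2, 3, 4}\<close> if \<open>a = 2\<close> and \<open>k \<ge> 5\<close>.\<close>
    define v :: nat where "v = (if a = 1 then 1 else 3)"
    have "accurate_dominating_set (path_graph n) (prepend_run a k D)"
    proof (rule accurate_dominating_setI)
      show "dominating_set (path_graph n) (prepend_run a k D)"
        using dominating_set_prepend_run D ak p by simp
      show "v \<in> prepend_run a k D"
        using ak p by (auto simp: v_def prepend_run_def)
      show "u \<in> prepend_run a k D" if "adjacent (path_graph n) u v" for u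
        using that ak p by (auto simp: v_def prepend_run_def adjacent_path_graph)
    qed
    moreover have "card (prepend_run a k D) = i"
      using D ak p by (simp add: card_prepend_run)
    ultimately show "f p \<in> A"
      by (simp add: f_def A_def)
  qed
  moreover have "finite A"
    using finite_dominating_sets_path_graph
    by (simp add: A_def accurate_dominating_set_def conj_assoc)
  ultimately have "card (Sigma I S) \<le> card A"
    by (rule card_inj_on_le)
  moreover have "card (Sigma I S) = (\<Sum>p\<in>I. card (S p))"
    by (intro card_SigmaI)
      (auto simp: I_def S_def intro: finite_dominating_sets_path_graph)
  moreover have "(\<Sum>p\<in>I. card (S p)) =
      (\<Sum>p\<in>{1} \<times> {3..i}. card (S p)) + (\<Sum>p\<in>{2} \<times> {5..i + 1}. card (S p))"
    unfolding I_def by (intro sum.union_disjoint) auto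
  moreover have "(\<Sum>p\<in>{c} \<times> T. card (S p)) = (\<Sum>k\<in>T. card (S (c, k)))" for c T
    by (rule sum.reindex_bij_witness[of _ "Pair c" snd]) auto
  \<comment> \<open>Since \<open>k \<le> i\<close>, the truncated differences
    \<open>i + 1 - k\<close> and \<open>i - k + 1\<close> agree.\<close>
  moreover have "(\<Sum>k = 3..i. card (S (1, k))) =
      (\<Sum>k = 3..i. num_dominating (path_graph (n - k)) (i - k + 1))"
    by (intro sum.cong) (auto simp: S_def num_dominating_def Suc_diff_le)
  moreover have "(\<Sum>k = 5..i + 1. card (S (2, k))) =
      (\<Sum>k = 5..i + 1. num_dominating (path_graph (n - k)) (i + 2 - k))"
    by (simp add: S_def num_dominating_def)
  ultimately show ?thesis
    by (simp add: A_def num_accurate_dominating_def)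
qed

end
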